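(* Let $H:\mathbb N\to\mathbb N$ be defined by $H(0)=0$ and $H(i)=i-H(H(H(i-1)))$ for $i\ge1$, and let $\alpha\approx1.46557123$ be the unique real root of $X^3-X^2-1$. Then for all $i\ge 0$, $H(i)-\lfloor \alpha^{-1} i\rfloor\in\{0,1\}$. *)

theory Defs
  imports Complex_Main
begin

function H :: "nat \<Rightarrow> nat" where
  "H 0 = 0"
| "H (Suc n) = Suc n - H (H (H n))"
  by pat_completeness auto

lemma H_dom_le: "H_dom n \<Longrightarrow> H n \<le> n"
  by (induction n rule: H.pinduct) (auto simp: H.psimps)

termination
proof (relation "measure (\<lambda>n. n)", goal_cases)
  case (3 n)
  then show ?case using H_dom_le[of n] by simp
next
  case (4 n)
  then show ?case using H_dom_le[of n] H_dom_le[of "H n"] by simp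
qed auto

lemma H_le: "H n \<le> n"
  by (cases n) auto

text \<open>The subtraction in the recursion is never truncated.\<close>

lemma H_rec_int:
  assumes "i \<ge> 1"
  shows "int (H i) = int i - int (H (H (H (i - 1))))"
proof -
  obtain n where i: "i = Suc n" using assms by (cases i) auto
  have "H (H (H n)) \<le> Suc n"
    using H_le[of n] H_le[of "H n"] H_le[of "H (H n)"] by linarith
  then show ?thesis by (simp add: i of_nat_diff)
qed

definition alpha :: real where
  "alpha = (THE x. x ^ 3 - x ^ 2 - 1 = 0)"

lemma cubic_ex1: "\<exists>!x::real. x ^ 3 - x ^ 2 - 1 = 0"
proof -
  have "\<exists>x\<ge>1. x \<le> 2 \<and> x ^ 3 - x ^ 2 - 1 = (0::real)"
    by (rule IVT') (auto intro!: continuous_intros)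
  then obtain a :: real where a: "a ^ 3 - a ^ 2 - 1 = 0" by blast
  have gt1: "x > 1" if "x ^ 3 - x ^ 2 - 1 = 0" for x :: real
  proof (rule ccontr)
    assume "\<not> x > 1"
    then have "x\<^sup>2 * (x - 1) \<le> 0" by (intro mult_nonneg_nonpos) auto
    with that show False by (simp add: power2_eq_square power3_eq_cube algebra_simps)
  qed
  have nless: "\<not> x < y" if "x ^ 3 - x ^ 2 - 1 = 0" "y ^ 3 - y ^ 2 - 1 = 0" for x y :: real
  proof
    assume "x < y"
    with gt1[OF that(1)] have "x\<^sup>2 * (x - 1) < y\<^sup>2 * (y - 1)"
      by (intro mult_strict_mono power_strict_mono) auto
    with that show False by (simp add: power2_eq_square power3_eq_cube algebra_simps)
  qed
  show ?thesis
    using a nless by (metis linorder_neqE)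
qed

lemma alpha_root: "alpha ^ 3 - alpha ^ 2 - 1 = 0"
  unfolding alpha_def by (rule theI'[OF cubic_ex1])

lemma alpha_approx: "1.46557123 < alpha" "alpha < 1.46557124"
proof -
  have "\<exists>x\<ge>1.465571231. x \<le> 1.465571232 \<and> x ^ 3 - x ^ 2 - 1 = (0::real)"
    by (rule IVT') (auto intro!: continuous_intros simp: power2_eq_square power3_eq_cube)
  then obtain a :: real where a: "a \<ge> 1.465571231" "a \<le> 1.465571232" "a ^ 3 - a ^ 2 - 1 = 0"
    by blast
  have "a = alpha" using cubic_ex1 a(3) alpha_root by blast
  with a show "1.46557123 < alpha" "alpha < 1.46557124" by auto
qed

end

theory Submission
  imports Defs
begin

text \<open>
  Put \<open>t = 1/\<alpha>\<close>, so \<open>t\<^sup>3 + t = 1\<close>, and \<open>\<delta> n = H n - t n\<close>. Let \<open>\<beta>\<close> be a complex root of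
  \<open>X\<^sup>3 - X\<^sup>2 - 1\<close>; then \<open>\<bar>\<beta>\<bar>\<^sup>2 = t\<close>. The complex number \<open>z n = \<delta> n - cnj \<beta> * \<delta> (H n)\<close> satisfies
  \<open>z n = \<beta> * z (H n)\<close> whenever \<open>H\<^sup>3 n = H\<^sup>3 (n - 1)\<close>. Otherwise \<open>H\<close>, \<open>H\<^sup>2\<close> and \<open>H\<^sup>3\<close> all increase by
  one from \<open>n - 1\<close> to \<open>n\<close>; the recursion then puts \<open>m = n - 1\<close>, \<open>H m\<close> and \<open>H (H m)\<close> in the first
  case, so \<open>z n = z 1 + \<beta>\<^sup>3 * z (H\<^sup>3 m)\<close>. As \<open>\<bar>\<beta>\<bar> < 1\<close>, this bounds \<open>\<bar>z\<bar>\<close>, and one further use of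
  the case distinction gives \<open>\<bar>\<delta>\<bar> < 1\<close>.
\<close>

text \<open>For \<open>n = Suc m\<close>, subtracting consecutive recursions gives 1 minus the
  increment of H^3 from \<open>m\<close> to \<open>n\<close>. Three uses of the induction hypothesis
  make that increment 0 or 1.\<close>

lemma H_Suc_cases: "H (Suc n) = H n \<or> H (Suc n) = Suc (H n)"
proof (induction n rule: less_induct)
  case (less n)
  show ?case
  proof (cases n)
    case 0
    then show ?thesis by simp
  next
    case (Suc m)
    have step: "H y = H x \<or> H y = Suc (H x)" if "x \<le> m" "y = x \<or> y = Suc x" for x y
      using less.IH[of x] that Suc by auto
    have 1: "H n = H m \<or> H n = Suc (H m)"
      using step[of m n] Suc by simp
    have 2: "H (H n) = H (H m) \<or> H (H n) = Suc (H (H m))"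
      using step[OF _ 1] H_le[of m] by simp
    have 3: "H (H (H n)) = H (H (H m)) \<or> H (H (H n)) = Suc (H (H (H m)))"
      using step[OF _ 2] H_le[of m] H_le[of "H m"] by simp
    have "int (H (Suc n)) = int (Suc n) - int (H (H (H n)))"
      using H_rec_int[of "Suc n"] by simp
    moreover have "int (H n) = int n - int (H (H (H m)))"
      using H_rec_int[of n] Suc by simp
    ultimately show ?thesis using 3 by linarith
  qed
qed

lemma H_pos: "n \<ge> 1 \<Longrightarrow> H n \<ge> 1"
proof (induction n rule: nat_induct_at_least)
  case base
  show ?case by simp
next
  case (Suc n)
  then show ?case using H_Suc_cases[of n] by auto
qed

lemma H_less:
  assumes "n \<ge> 2"
  shows "H n < n"
proof -
  have "H (H (H (n - 1))) \<ge> 1"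
    using assms by (intro H_pos) simp
  with H_rec_int[of n] assms show ?thesis by simp
qed

text \<open>Turns an increase of \<open>H\<close> right after \<open>n\<close> into the hypothesis
  of \<open>z_contract\<close> at \<open>n\<close>.\<close>

lemma H_Suc_eq_Suc_iff:
  assumes "n \<ge> 1"
  shows "H (Suc n) = Suc (H n) \<longleftrightarrow> H (H (H n)) = H (H (H (n - 1)))"
  using H_rec_int[of "Suc n"] H_rec_int[of n] assms by auto

text \<open>Once an inner application of \<open>H\<close> does not move, neither do the outer ones,
  so H^3 moves only together with H and H^2.\<close>

lemma H3_Suc_cases:
  obtains (eq) "H (H (H (Suc n))) = H (H (H n))"
  | (incr) "H (Suc n) = Suc (H n)" "H (H (Suc n)) = Suc (H (H n))"
      "H (H (H (Suc n))) = Suc (H (H (H n)))"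
  using H_Suc_cases[of n] H_Suc_cases[of "H n"] H_Suc_cases[of "H (H n)"] by force

definition t :: real where "t = inverse alpha"

lemma t_cubic: "t ^ 3 + t = 1"
proof -
  have pos: "alpha > 0" using alpha_approx by simp
  have "t ^ 3 + t - 1 = - (alpha ^ 3 - alpha ^ 2 - 1) / alpha ^ 3"
    using pos by (simp add: t_def divide_simps) (simp add: power2_eq_square power3_eq_cube algebra_simps)
  then show ?thesis using alpha_root by simp
qed

lemma t_bounds: "0.6823 < t" "t < 0.6824"
  using alpha_approx by (simp_all add: t_def field_simps)

text \<open>The two non-real roots of X^3 - X^2 - 1 have sum 1 - \<open>alpha\<close> = -t^2 and
  product 1/\<open>alpha\<close> = t; this is the one in the upper half plane.\<close>

definition \<beta> :: complex where
  "\<beta> = Complex (- (t\<^sup>2 / 2)) (sqrt (t - t ^ 4 / 4))"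

lemma t_power_bounds: "t\<^sup>2 < 0.4657" "t ^ 3 < 0.3178" "t ^ 4 < 0.2169"
proof -
  have "t ^ k < 0.6824 ^ k" if "k > 0" for k
    using t_bounds that by (intro power_strict_mono) auto
  from this[of 2] this[of 3] this[of 4]
  show "t\<^sup>2 < 0.4657" "t ^ 3 < 0.3178" "t ^ 4 < 0.2169"
    by (simp_all add: power_divide)
qed

lemma \<beta>_Im_sq: "(Im \<beta>)\<^sup>2 = t - t ^ 4 / 4"
  using t_bounds t_power_bounds by (simp add: \<beta>_def)

lemma \<beta>_add_cnj: "\<beta> + cnj \<beta> = - of_real (t\<^sup>2)"
  by (simp add: complex_eq_iff \<beta>_def)

lemma norm_\<beta>_sq: "(cmod \<beta>)\<^sup>2 = t"
  unfolding cmod_power2 \<beta>_Im_sq by (simp add: \<beta>_def power2_eq_square power4_eq_xxxx)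

lemma \<beta>_mult_cnj: "\<beta> * cnj \<beta> = of_real t"
  by (simp add: complex_norm_square[symmetric] norm_\<beta>_sq flip: of_real_power)

lemma norm_\<beta>_less: "cmod \<beta> < 0.8261"
  by (rule power2_less_imp_less) (use t_bounds in \<open>simp_all add: norm_\<beta>_sq power_divide\<close>)

lemma norm_\<beta>_cube_less: "cmod \<beta> ^ 3 < 0.564"
proof -
  have "cmod \<beta> ^ 3 < 0.8261 ^ 3"
    by (intro power_strict_mono norm_\<beta>_less) auto
  then show ?thesis by (simp add: power_divide)
qed

definition \<delta> :: "nat \<Rightarrow> real" where
  "\<delta> n = real (H n) - t * real n"

definition z :: "nat \<Rightarrow> complex" where
  "z n = of_real (\<delta> n) - cnj \<beta> * of_real (\<delta> (H n))"

lemma z_0 [simp]: "z 0 = 0"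
  by (simp add: z_def \<delta>_def)

lemma norm_linear_sq:
  "(cmod (of_real a - cnj \<beta> * of_real b))\<^sup>2 = a\<^sup>2 + t\<^sup>2 * a * b + t * b\<^sup>2"
proof -
  have "(cmod (of_real a - cnj \<beta> * of_real b))\<^sup>2
      = a\<^sup>2 + t\<^sup>2 * a * b + ((Re \<beta>)\<^sup>2 + (Im \<beta>)\<^sup>2) * b\<^sup>2"
    unfolding cmod_power2 by (simp add: \<beta>_def power2_eq_square algebra_simps)
  then show ?thesis by (simp add: cmod_power2[symmetric] norm_\<beta>_sq)
qed

text \<open>Complete the square in \<open>\<delta> (H n)\<close>; the constant comes from 1 -
  0.3178/4 > 0.92.\<close>

lemma \<delta>_sq_le: "0.92 * (\<delta> n)\<^sup>2 \<le> (cmod (z n))\<^sup>2"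
proof -
  let ?a = "\<delta> n" and ?b = "\<delta> (H n)"
  have "(cmod (z n))\<^sup>2 = t * (?b + t * ?a / 2)\<^sup>2 + (1 - t ^ 3 / 4) * ?a\<^sup>2"
    unfolding z_def norm_linear_sq
    by (simp add: power2_eq_square power3_eq_cube field_simps)
  moreover have "t * (?b + t * ?a / 2)\<^sup>2 \<ge> 0"
    using t_bounds by simp
  moreover have "0.92 * ?a\<^sup>2 \<le> (1 - t ^ 3 / 4) * ?a\<^sup>2"
    using t_power_bounds by (intro mult_right_mono) auto
  ultimately show ?thesis by linarith
qed

text \<open>Here n = H n + H^3 n, so \<delta> obeys a linear recurrence along n, H n, H^2 n with
  characteristic polynomial X^2 + t^2 X + t = (X - \<beta>)(X - cnj \<beta>). Passing to
  \<open>z\<close> splits off the factor X - cnj \<beta>.\<close>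

lemma z_contract:
  assumes "n \<ge> 1" "H (H (H n)) = H (H (H (n - 1)))"
  shows "z n = \<beta> * z (H n)"
proof -
  define x y w where "x = real (H n)" and "y = real (H (H n))" and "w = real (H (H (H n)))"
  have "int n = int (H n) + int (H (H (H n)))"
    using H_rec_int[of n] assms by simp
  then have n: "real n = x + w"
    unfolding x_def w_def by linarith
  have "\<delta> n = - t\<^sup>2 * \<delta> (H n) - t * \<delta> (H (H n))"
  proof -
    have "x - t * (x + w) - (- t\<^sup>2 * (y - t * x) - t * (w - t * y)) = (1 - t - t ^ 3) * x"
      by (simp add: power2_eq_square power3_eq_cube algebra_simps)
    moreover have "1 - t - t ^ 3 = 0"
      using t_cubic by simp
    ultimately show ?thesis
      by (simp add: \<delta>_def n flip: x_def y_def w_def)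
  qed
  then have "of_real (\<delta> n) = (\<beta> + cnj \<beta>) * of_real (\<delta> (H n)) - (\<beta> * cnj \<beta>) * of_real (\<delta> (H (H n)))"
    unfolding \<beta>_add_cnj \<beta>_mult_cnj by simp
  then show ?thesis
    by (simp add: z_def algebra_simps)
qed

text \<open>The number measured is \<open>z 1\<close>, the jump of \<open>z\<close> whenever H and
  H^2 both increase.\<close>

lemma norm_z_incr: "cmod (of_real (1 - t) - cnj \<beta> * of_real (1 - t)) = t\<^sup>2"
proof (rule power2_eq_imp_eq)
  have "(1 - t)\<^sup>2 + t\<^sup>2 * (1 - t) * (1 - t) + t * (1 - t)\<^sup>2 = (1 - t) * (1 - t ^ 3)"
    by (simp add: power2_eq_square power3_eq_cube algebra_simps)
  \<comment> \<open>\<open>t_cubic\<close> gives both 1 - t = t^3 and 1 - t^3 = t.\<close>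
  also have "\<dots> = t ^ 3 * t"
    using t_cubic by (simp add: algebra_simps)
  also have "\<dots> = (t\<^sup>2)\<^sup>2"
    by (simp add: power2_eq_square power3_eq_cube)
  finally show "(cmod (of_real (1 - t) - cnj \<beta> * of_real (1 - t)))\<^sup>2 = (t\<^sup>2)\<^sup>2"
    unfolding norm_linear_sq .
qed auto

lemma z_cases:
  assumes "n \<ge> 1"
  obtains (contract) "n \<ge> 2" "z n = \<beta> * z (H n)"
  | (incr) m where "n = Suc m" "\<delta> n = \<delta> m + (1 - t)"
      "z n = z m + (of_real (1 - t) - cnj \<beta> * of_real (1 - t))"
      "z m = \<beta> ^ 3 * z (H (H (H m)))"
proof -
  obtain m where n: "n = Suc m" using assms by (cases n) auto
  show ?thesis
  proof (cases rule: H3_Suc_cases[of m])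
    case eq
    \<comment> \<open>H^3 does move from 0 to 1. Hence \<open>n \<ge> 2\<close>, as
      \<open>H_less\<close> requires.\<close>
    then have "m \<noteq> 0" by (intro notI) simp
    with eq n z_contract[of n] show ?thesis by (intro contract) (simp_all del: H.simps)
  next
    case H: incr
    have d: "\<delta> n = \<delta> m + (1 - t)" "\<delta> (H n) = \<delta> (H m) + (1 - t)"
      using H by (simp_all add: n \<delta>_def algebra_simps del: H.simps)
    have zn: "z n = z m + (of_real (1 - t) - cnj \<beta> * of_real (1 - t))"
      unfolding z_def d by (simp add: algebra_simps)
    have "z m = \<beta> ^ 3 * z (H (H (H m)))"
    proof (cases "m = 0")
      case False
      \<comment> \<open>Applies to m, H m and H^2 m: since H (m + 1) = H m + 1, the increase of H^2
        is an increase of \<open>H\<close> right after H m, and likewise one level deeper.\<close>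
      have contr: "z k = \<beta> * z (H k)" if "k \<ge> 1" "H (Suc k) = Suc (H k)" for k
        using z_contract[of k] H_Suc_eq_Suc_iff[of k] that by simp
      have pos: "m \<ge> 1" "H m \<ge> 1" "H (H m) \<ge> 1"
        using False H_pos[of m] H_pos[of "H m"] by simp_all
      have "z m = \<beta> * z (H m)" "z (H m) = \<beta> * z (H (H m))" "z (H (H m)) = \<beta> * z (H (H (H m)))"
        using contr[OF pos(1)] contr[OF pos(2)] contr[OF pos(3)] H by (simp_all del: H.simps)
      then show ?thesis by (simp add: power3_eq_cube mult.assoc)
    qed simp
    with n d zn show ?thesis by (intro incr) auto
  qed
qed

text \<open>
  The constant only has to exceed \<open>t\<^sup>2 / (1 - t powr (3/2)) \<approx> 1.067\<close>, the fixed point of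
  \<open>r = t\<^sup>2 + \<bar>\<beta>\<bar>\<^sup>3 * r\<close>.
\<close>

lemma norm_z_le: "cmod (z n) \<le> 1.07"
proof (induction n rule: less_induct)
  case (less n)
  show ?case
  proof (cases "n = 0")
    case False
    then have "n \<ge> 1" by simp
    then show ?thesis
    proof (cases rule: z_cases)
      case contract
      have "cmod (z n) \<le> 1 * 1.07"
        unfolding contract norm_mult
        using norm_\<beta>_less less.IH[OF H_less[OF contract(1)]] by (intro mult_mono) auto
      then show ?thesis by simp
    next
      case (incr m)
      have "H (H (H m)) < n"
        using H_le[of m] H_le[of "H m"] H_le[of "H (H m)"] incr(1) by linarith
      then have "cmod (z m) \<le> 0.564 * 1.07"
        unfolding incr(4) norm_mult norm_power
        using norm_\<beta>_cube_less less.IH by (intro mult_mono) auto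
      moreover have "cmod (z n) \<le> cmod (z m) + t\<^sup>2"
        unfolding incr(3) norm_z_incr[symmetric] by (rule norm_triangle_ineq)
      ultimately show ?thesis using t_power_bounds by simp
    qed
  qed simp
qed

text \<open>Directly, \<open>norm_z_le\<close> and \<open>\<delta>_sq_le\<close> give only
  \<delta>^2 \<le> 1.07^2/0.92, which exceeds 1. A contraction gains the missing factor; otherwise
  the factor \<beta>^3 keeps \<open>\<delta> m\<close> below 0.65, leaving room for the jump 1 - t <
  0.32.\<close>

lemma abs_\<delta>_less_1: "\<bar>\<delta> n\<bar> < 1"
proof (cases "n = 0")
  case True
  then show ?thesis by (simp add: \<delta>_def)
next
  case False
  then have "n \<ge> 1" by simp
  then show ?thesis
  proof (cases rule: z_cases)
    case contract
    have "cmod (z n) \<le> 0.8261 * 1.07"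
      unfolding contract norm_mult using norm_\<beta>_less norm_z_le by (intro mult_mono) auto
    then have "(cmod (z n))\<^sup>2 \<le> (0.8261 * 1.07)\<^sup>2"
      by (intro power_mono) auto
    with \<delta>_sq_le[of n] have "(\<delta> n)\<^sup>2 < 1"
      by (simp add: power_divide)
    then show ?thesis by (simp add: abs_square_less_1)
  next
    case (incr m)
    have "cmod (z m) \<le> 0.564 * 1.07"
      unfolding incr(4) norm_mult norm_power
      using norm_\<beta>_cube_less norm_z_le by (intro mult_mono) auto
    then have "(cmod (z m))\<^sup>2 \<le> (0.564 * 1.07)\<^sup>2"
      by (intro power_mono) auto
    with \<delta>_sq_le[of m] have "\<bar>\<delta> m\<bar>\<^sup>2 < 0.65\<^sup>2"
      by (simp add: power_divide)
    then have "\<bar>\<delta> m\<bar> < 0.65"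
      by (rule power2_less_imp_less) simp
    then show ?thesis using incr(2) t_bounds by simp
  qed
qed

theorem theorem34:
  fixes i :: nat
  shows "int (H i) - \<lfloor>inverse alpha * real i\<rfloor> \<in> {0, 1}"
proof -
  have "\<bar>real (H i) - inverse alpha * real i\<bar> < 1"
    using abs_\<delta>_less_1[of i] by (simp add: \<delta>_def t_def)
  \<comment> \<open>An integer at distance less than 1 from a real y is the floor of y or its
    successor.\<close>
  then show ?thesis
    by (simp, linarith)
qed

end
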